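(* The pair $(\mathbf{Top},\mathbf{Cov}_{\mathbf{Gl}}(\mathbf{Top}))$ is a Grothendieck site, and the pair $(\mathbf{oTop},\mathbf{Cov}_{\mathbf{Gl}}(\mathbf{oTop}))$ is a Grothendieck site.
   Context: $\mathbf{Top}$ is the category of topological spaces and continuous maps; $\mathbf{oTop}$ is its subcategory with objects all topological spaces and morphisms the open continuous maps. A gluing covering (respectively gluing open covering) of a topological space $U$ is a family $\{\iota_i:U_i\to U\}_{i\in\mathrm{I}}$ indexed by a set $\mathrm{I}$, with $U_i$ topological spaces, such that each $\iota_i$ is a one-to-one continuous map (respectively a one-to-one open continuous map) and $\bigcup_{i\in\mathrm{I}}\iota_i(U_i)=U$. $\mathbf{Cov}_{\mathbf{Gl}}(\mathbf{Top})$ (respectively $\mathbf{Cov}_{\mathbf{Gl}}(\mathbf{oTop})$) is the collection of all gluing coverings (respectively gluing open coverings) of all topological spaces. A pair $(\mathbf{C},\mathbf{Cov})$, with $\mathbf{Cov}$ a collection of families $\{U_i\to U\}_{i\in\mathrm{I}}$ of morphisms of $\mathbf{C}$ with common codomain, is a Grothendieck site if: (1) if $\varphi:V\to U$ is an isomorphism in $\mathbf{C}$, then $\{\varphi:V\to U\}\in\mathbf{Cov}$; (2) if $\{\iota_i:U_i\to U\}_{i\in\mathrm{I}}\in\mathbf{Cov}$ and, for every $i\in\mathrm{I}$, $\{\ell_{i,j}:V_{i,j}\to U_i\}_{j\in\mathrm{J}_i}\in\mathbf{Cov}$, then $\{\iota_i\circ\ell_{i,j}:V_{i,j}\to U\}_{i\in\mathrm{I},j\in\mathrm{J}_i}\in\mathbf{Cov}$;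 (3) if $\{\iota_i:U_i\to U\}_{i\in\mathrm{I}}\in\mathbf{Cov}$, $\varphi:V\to U$ is a morphism of $\mathbf{C}$, and the pullback $U_i\times_U V$ exists for all $i\in\mathrm{I}$, then the family of canonical projections $\{U_i\times_U V\to V\}_{i\in\mathrm{I}}$ is in $\mathbf{Cov}$. *)

theory Defs
  imports "HOL-Analysis.Analysis"
begin

section \<open>Categories, isomorphisms, pullbacks\<close>

record ('o, 'm) cat_data =
  Obj :: "'o set"
  Arr :: "'m set"
  Dom :: "'m \<Rightarrow> 'o"
  Cod :: "'m \<Rightarrow> 'o"
  Ident :: "'o \<Rightarrow> 'm"
  Comp :: "'m \<Rightarrow> 'm \<Rightarrow> 'm"

text \<open>\<open>Comp C g f\<close> is \<open>g\<close> after \<open>f\<close>; it is only meaningful if \<open>Cod C f = Dom C g\<close>.\<close>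

locale category =
  fixes C :: "('o, 'm) cat_data"
  assumes dom_obj: "f \<in> Arr C \<Longrightarrow> Dom C f \<in> Obj C"
    and cod_obj: "f \<in> Arr C \<Longrightarrow> Cod C f \<in> Obj C"
    and ident_arr: "X \<in> Obj C \<Longrightarrow> Ident C X \<in> Arr C"
    and ident_dom: "X \<in> Obj C \<Longrightarrow> Dom C (Ident C X) = X"
    and ident_cod: "X \<in> Obj C \<Longrightarrow> Cod C (Ident C X) = X"
    and comp_arr: "\<lbrakk>f \<in> Arr C; g \<in> Arr C; Cod C f = Dom C g\<rbrakk> \<Longrightarrow> Comp C g f \<in> Arr C"
    and comp_dom: "\<lbrakk>f \<in> Arr C; g \<in> Arr C; Cod C f = Dom C g\<rbrakk> \<Longrightarrow> Dom C (Comp C g f) = Dom C f"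
    and comp_cod: "\<lbrakk>f \<in> Arr C; g \<in> Arr C; Cod C f = Dom C g\<rbrakk> \<Longrightarrow> Cod C (Comp C g f) = Cod C g"
    and comp_ident_right: "f \<in> Arr C \<Longrightarrow> Comp C f (Ident C (Dom C f)) = f"
    and comp_ident_left: "f \<in> Arr C \<Longrightarrow> Comp C (Ident C (Cod C f)) f = f"
    and comp_assoc: "\<lbrakk>f \<in> Arr C; g \<in> Arr C; h \<in> Arr C; Cod C f = Dom C g; Cod C g = Dom C h\<rbrakk>
      \<Longrightarrow> Comp C h (Comp C g f) = Comp C (Comp C h g) f"

definition is_iso :: "('o, 'm) cat_data \<Rightarrow> 'm \<Rightarrow> bool" where
  "is_iso C f \<longleftrightarrow> f \<in> Arr C \<and>
     (\<exists>g \<in> Arr C. Dom C g = Cod C f \<and> Cod C g = Dom C f \<and>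
        Comp C g f = Ident C (Dom C f) \<and> Comp C f g = Ident C (Cod C f))"

definition is_cone :: "('o, 'm) cat_data \<Rightarrow> 'm \<Rightarrow> 'm \<Rightarrow> 'm \<Rightarrow> 'm \<Rightarrow> bool" where
  "is_cone C f g p q \<longleftrightarrow> p \<in> Arr C \<and> q \<in> Arr C \<and> Dom C p = Dom C q \<and>
     Cod C p = Dom C f \<and> Cod C q = Dom C g \<and> Comp C f p = Comp C g q"

text \<open>The common domain of \<open>p\<close> and \<open>q\<close> is a pullback of \<open>f\<close> and \<open>g\<close>, with projections
  \<open>p\<close> to the domain of \<open>f\<close> and \<open>q\<close> to the domain of \<open>g\<close>.\<close>

definition is_pullback :: "('o, 'm) cat_data \<Rightarrow> 'm \<Rightarrow> 'm \<Rightarrow> 'm \<Rightarrow> 'm \<Rightarrow> bool" where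
  "is_pullback C f g p q \<longleftrightarrow>
     f \<in> Arr C \<and> g \<in> Arr C \<and> Cod C f = Cod C g \<and> is_cone C f g p q \<and>
     (\<forall>p' q'. is_cone C f g p' q' \<longrightarrow>
        (\<exists>!h. h \<in> Arr C \<and> Dom C h = Dom C p' \<and> Cod C h = Dom C p \<and>
              Comp C p h = p' \<and> Comp C q h = q'))"


section \<open>Grothendieck sites\<close>

text \<open>A family of morphisms with common codomain \<open>U\<close> is a triple \<open>(U, I, \<iota>)\<close>. The codomain is
  recorded because \<open>I\<close> may be empty, and \<open>\<iota>\<close> is extensional, so that a family carries no
  information outside its index set.\<close>

type_synonym ('o, 'i, 'm) family = "'o \<times> 'i set \<times> ('i \<Rightarrow> 'm)"

definition families :: "('o, 'm) cat_data \<Rightarrow> ('o, 'i, 'm) family set" where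
  "families C = {(U, I, \<iota>). U \<in> Obj C \<and> \<iota> \<in> I \<rightarrow>\<^sub>E {f \<in> Arr C. Cod C f = U}}"

text \<open>Index sets are subsets of one arbitrary type \<open>'i\<close>, whereas the composite family in
  \<open>cov_comp\<close> is indexed by the pairs \<open>(i, j)\<close> with \<open>i \<in> I\<close>, \<open>j \<in> J i\<close>. It is therefore
  required to be a covering under every enumeration \<open>e\<close> of these pairs by a set \<open>K\<close> of
  indices; if \<open>'i\<close> is infinite, such \<open>K\<close> and \<open>e\<close> always exist. In \<open>cov_pullback\<close>, \<open>p\<close> and \<open>q\<close>
  range over all choices of pullbacks.\<close>

locale grothendieck_site = category C
  for C :: "('o, 'm) cat_data" +
  fixes Cov :: "('o, 'i, 'm) family set"
  assumes cov_families: "Cov \<subseteq> families C"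
    and cov_iso: "is_iso C \<phi> \<Longrightarrow> (Cod C \<phi>, {i}, \<lambda>_\<in>{i}. \<phi>) \<in> Cov"
    and cov_comp:
      "\<lbrakk>(U, I, \<iota>) \<in> Cov; \<And>i. i \<in> I \<Longrightarrow> (Dom C (\<iota> i), J i, l i) \<in> Cov;
        bij_betw e K (SIGMA i:I. J i)\<rbrakk>
       \<Longrightarrow> (U, K, \<lambda>k\<in>K. case e k of (i, j) \<Rightarrow> Comp C (\<iota> i) (l i j)) \<in> Cov"
    and cov_pullback:
      "\<lbrakk>(U, I, \<iota>) \<in> Cov; \<phi> \<in> Arr C; Cod C \<phi> = U;
        \<And>i. i \<in> I \<Longrightarrow> is_pullback C (\<iota> i) \<phi> (p i) (q i)\<rbrakk>
       \<Longrightarrow> (Dom C \<phi>, I, \<lambda>i\<in>I. q i) \<in> Cov"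


section \<open>The categories Top and oTop\<close>

text \<open>The spaces are all topologies carried by subsets of an arbitrary type \<open>'a\<close>, which plays the
  role of the universe. Underlying functions of morphisms are extensional, so that equality of
  morphisms is equality of maps.\<close>

datatype 'a top_map = Top_Map
  (map_dom: "'a topology") (map_fun: "'a \<Rightarrow> 'a") (map_cod: "'a topology")

definition Top :: "('a topology, 'a top_map) cat_data" where
  "Top = \<lparr>Obj = UNIV,
          Arr = {f. continuous_map (map_dom f) (map_cod f) (map_fun f) \<and>
                    map_fun f \<in> extensional (topspace (map_dom f))},
          Dom = map_dom,
          Cod = map_cod,
          Ident = (\<lambda>X. Top_Map X (\<lambda>x\<in>topspace X. x) X),
          Comp = (\<lambda>g f. Top_Map (map_dom f)
                    (compose (topspace (map_dom f)) (map_fun g) (map_fun f)) (map_cod g))\<rparr>"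

definition oTop :: "('a topology, 'a top_map) cat_data" where
  "oTop = Top\<lparr>Arr := {f \<in> Arr Top. open_map (map_dom f) (map_cod f) (map_fun f)}\<rparr>"


section \<open>Gluing coverings\<close>

definition gluing_covering :: "('a topology, 'i, 'a top_map) family \<Rightarrow> bool" where
  "gluing_covering = (\<lambda>(U, I, \<iota>). (U, I, \<iota>) \<in> families Top \<and>
     (\<forall>i\<in>I. inj_on (map_fun (\<iota> i)) (topspace (map_dom (\<iota> i)))) \<and>
     (\<Union>i\<in>I. map_fun (\<iota> i) ` topspace (map_dom (\<iota> i))) = topspace U)"

definition gluing_open_covering :: "('a topology, 'i, 'a top_map) family \<Rightarrow> bool" where
  "gluing_open_covering = (\<lambda>(U, I, \<iota>). (U, I, \<iota>) \<in> families oTop \<and>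
     (\<forall>i\<in>I. inj_on (map_fun (\<iota> i)) (topspace (map_dom (\<iota> i)))) \<and>
     (\<Union>i\<in>I. map_fun (\<iota> i) ` topspace (map_dom (\<iota> i))) = topspace U)"

definition Cov_Gl_Top :: "('a topology, 'i, 'a top_map) family set" where
  "Cov_Gl_Top = {F. gluing_covering F}"

definition Cov_Gl_oTop :: "('a topology, 'i, 'a top_map) family set" where
  "Cov_Gl_oTop = {F. gluing_open_covering F}"

end

theory Submission
  imports Defs
begin

text \<open>
  Isomorphisms are bijections, and jointly surjective families of injective (open) maps compose;
  this gives the first two site axioms. The content lies in stability under pullback. The index
  sets of a covering and of its pulled-back family agree, so it is enough to look at one
  injective map \<open>\<iota> : U\<^sub>i \<rightarrow> U\<close>, one map \<open>\<phi> : V \<rightarrow> U\<close> and one pullback \<open>P\<close> with projections \<open>p\<close>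
  and \<open>q : P \<rightarrow> V\<close>, and to show that \<open>q\<close> is injective with image \<open>\<phi>\<^sup>-\<^sup>1(\<iota>(U\<^sub>i))\<close>: as the sets
  \<open>\<iota>(U\<^sub>i)\<close> cover \<open>U\<close>, their preimages cover \<open>V\<close>.

  Since pullbacks are given only by their universal property, this has to be extracted by
  testing against suitable cones. In \<open>Top\<close> a one-point space suffices, because
  maps out of it are the points of a space (\<open>pullback_injective_Top\<close>). In \<open>oTop\<close>
  that test is not available, since the inclusion of a point need not be open. There the set
  \<open>\<phi>\<^sup>-\<^sup>1(\<iota>(U\<^sub>i))\<close> is open in \<open>V\<close>, and as a subspace \<open>W\<close> of \<open>V\<close>, with its inclusion into \<open>V\<close> and
  the map \<open>\<iota>\<^sup>-\<^sup>1 \<circ> \<phi>\<close> into \<open>U\<^sub>i\<close>, it is itself a cone of open maps. It induces \<open>h : W \<rightarrow> P\<close> with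
  \<open>q \<circ> h\<close> the inclusion, so \<open>q\<close> covers \<open>W\<close>; conversely \<open>q\<close> corestricts to \<open>k : P \<rightarrow> W\<close>, and
  uniqueness of mediating arrows forces \<open>h \<circ> k = id\<close>, so \<open>q\<close> is injective
  (\<open>pullback_injective_oTop\<close>).
\<close>

section \<open>The categories of spaces\<close>

lemma Top_simps [simp]:
  "Obj Top = UNIV" "Dom Top = map_dom" "Cod Top = map_cod"
  "Ident Top X = Top_Map X (\<lambda>x\<in>topspace X. x) X"
  "Comp Top g f = Top_Map (map_dom f)
     (compose (topspace (map_dom f)) (map_fun g) (map_fun f)) (map_cod g)"
  by (simp_all add: Top_def)

lemma oTop_simps [simp]:
  "Obj oTop = UNIV" "Dom oTop = map_dom" "Cod oTop = map_cod"
  "Ident oTop = Ident Top" "Comp oTop = Comp Top"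
  by (simp_all add: oTop_def)

lemma Arr_Top_iff:
  "f \<in> Arr Top \<longleftrightarrow> continuous_map (map_dom f) (map_cod f) (map_fun f) \<and>
     map_fun f \<in> extensional (topspace (map_dom f))"
  by (simp add: Top_def)

lemma Arr_oTop_iff:
  "f \<in> Arr oTop \<longleftrightarrow> f \<in> Arr Top \<and> open_map (map_dom f) (map_cod f) (map_fun f)"
  by (simp add: oTop_def)

lemma Arr_Top_funcset:
  "f \<in> Arr Top \<Longrightarrow> x \<in> topspace (map_dom f) \<Longrightarrow> map_fun f x \<in> topspace (map_cod f)"
  by (auto simp: Arr_Top_iff continuous_map_def)

lemma Arr_Top_eqI:
  assumes "f \<in> Arr Top" "g \<in> Arr Top" "map_dom f = map_dom g" "map_cod f = map_cod g"
    and "\<And>x. x \<in> topspace (map_dom f) \<Longrightarrow> map_fun f x = map_fun g x"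
  shows "f = g"
proof -
  have "map_fun f = map_fun g"
    using assms by (intro extensionalityI[of _ "topspace (map_dom f)"]) (auto simp: Arr_Top_iff)
  then show ?thesis using assms by (simp add: top_map.expand)
qed

lemma continuous_map_compose_ext:
  assumes "continuous_map X Y f" "continuous_map Y Z g"
  shows "continuous_map X Z (compose (topspace X) g f)"
  by (rule continuous_map_eq[OF continuous_map_compose[OF assms]]) (simp add: compose_def)

lemma open_map_compose_ext:
  assumes "open_map X Y f" "open_map Y Z g"
  shows "open_map X Z (compose (topspace X) g f)"
  by (rule open_map_eq[OF open_map_compose[OF assms]]) (simp add: compose_def)

lemma Comp_Arr_Top:
  "\<lbrakk>f \<in> Arr Top; g \<in> Arr Top; map_cod f = map_dom g\<rbrakk> \<Longrightarrow> Comp Top g f \<in> Arr Top"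
  by (auto simp: Arr_Top_iff intro: continuous_map_compose_ext)

lemma Comp_Arr_oTop:
  "\<lbrakk>f \<in> Arr oTop; g \<in> Arr oTop; map_cod f = map_dom g\<rbrakk> \<Longrightarrow> Comp Top g f \<in> Arr oTop"
  using Comp_Arr_Top[of f g] by (auto simp: Arr_oTop_iff intro: open_map_compose_ext)

lemma Ident_Arr_Top: "Ident Top X \<in> Arr Top"
  by (auto simp: Arr_Top_iff intro: continuous_map_eq[OF continuous_map_id])

lemma Ident_Arr_oTop: "Ident Top X \<in> Arr oTop"
  using Ident_Arr_Top[of X] by (auto simp: Arr_oTop_iff intro: open_map_eq[OF open_map_id])

lemma category_Top: "category Top"
proof
  fix f :: "'a top_map" assume f: "f \<in> Arr Top"
  show "Comp Top f (Ident Top (Dom Top f)) = f"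
    by (rule Arr_Top_eqI) (use f Comp_Arr_Top[OF Ident_Arr_Top f] in \<open>auto simp: compose_def\<close>)
  show "Comp Top (Ident Top (Cod Top f)) f = f"
    by (rule Arr_Top_eqI)
      (use f Comp_Arr_Top[OF f Ident_Arr_Top] in \<open>auto simp: compose_def Arr_Top_funcset\<close>)
next
  fix f g h :: "'a top_map"
  assume "f \<in> Arr Top" "g \<in> Arr Top" "h \<in> Arr Top" "Cod Top f = Dom Top g" "Cod Top g = Dom Top h"
  then show "Comp Top h (Comp Top g f) = Comp Top (Comp Top h g) f"
    by (auto simp: compose_def fun_eq_iff restrict_def dest: Arr_Top_funcset)
qed (use Ident_Arr_Top Comp_Arr_Top in auto)

lemma category_oTop: "category oTop"
proof -
  interpret T: category Top by (rule category_Top)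
  show ?thesis
  proof
    fix f :: "'a top_map" assume "f \<in> Arr oTop"
    then have f: "f \<in> Arr Top" by (simp add: Arr_oTop_iff)
    show "Comp oTop f (Ident oTop (Dom oTop f)) = f"
      using T.comp_ident_right[OF f] by simp
    show "Comp oTop (Ident oTop (Cod oTop f)) f = f"
      using T.comp_ident_left[OF f] by simp
  next
    fix f g h :: "'a top_map"
    assume "f \<in> Arr oTop" "g \<in> Arr oTop" "h \<in> Arr oTop"
      and "Cod oTop f = Dom oTop g" "Cod oTop g = Dom oTop h"
    then show "Comp oTop h (Comp oTop g f) = Comp oTop (Comp oTop h g) f"
      using T.comp_assoc[of f g h] by (simp add: Arr_oTop_iff)
  qed (use Ident_Arr_oTop Comp_Arr_oTop in auto)
qed

section \<open>Isomorphisms and composite coverings\<close>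

lemma gluing_covering_iff:
  "gluing_covering (U, I, \<iota>) \<longleftrightarrow>
     \<iota> \<in> extensional I \<and> (\<forall>i\<in>I. \<iota> i \<in> Arr Top \<and> map_cod (\<iota> i) = U \<and>
       inj_on (map_fun (\<iota> i)) (topspace (map_dom (\<iota> i)))) \<and>
     (\<Union>i\<in>I. map_fun (\<iota> i) ` topspace (map_dom (\<iota> i))) = topspace U"
  by (auto simp: gluing_covering_def families_def PiE_iff)

lemma gluing_open_covering_iff:
  "gluing_open_covering (U, I, \<iota>) \<longleftrightarrow>
     gluing_covering (U, I, \<iota>) \<and> (\<forall>i\<in>I. \<iota> i \<in> Arr oTop)"
  by (auto simp: gluing_open_covering_def gluing_covering_def families_def PiE_iff Arr_oTop_iff)

lemma is_iso_oTop_imp_Top: "is_iso oTop f \<Longrightarrow> is_iso Top f"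
  by (auto simp: is_iso_def Arr_oTop_iff)

lemma is_iso_Top_bij:
  assumes "is_iso Top f"
  shows "bij_betw (map_fun f) (topspace (map_dom f)) (topspace (map_cod f))"
proof -
  obtain g where f: "f \<in> Arr Top" and g: "g \<in> Arr Top"
    and dc: "map_dom g = map_cod f" "map_cod g = map_dom f"
    and gf: "compose (topspace (map_dom f)) (map_fun g) (map_fun f) = (\<lambda>x\<in>topspace (map_dom f). x)"
    and fg: "compose (topspace (map_dom g)) (map_fun f) (map_fun g) = (\<lambda>x\<in>topspace (map_cod f). x)"
    using assms by (auto simp: is_iso_def)
  have "map_fun g (map_fun f x) = x" if "x \<in> topspace (map_dom f)" for x
    using fun_cong[OF gf, of x] that by (simp add: compose_def)
  moreover have "map_fun f (map_fun g y) = y" if "y \<in> topspace (map_cod f)" for y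
    using fun_cong[OF fg, of y] that dc by (simp add: compose_def)
  ultimately show ?thesis
    using Arr_Top_funcset[OF f] Arr_Top_funcset[OF g] dc
    by (intro bij_betw_byWitness[where f' = "map_fun g"]) auto
qed

lemma gluing_covering_iso:
  assumes "is_iso Top f"
  shows "gluing_covering (map_cod f, {i}, \<lambda>_\<in>{i}. f)"
  using is_iso_Top_bij[OF assms] assms
  by (auto simp: gluing_covering_iff is_iso_def bij_betw_def)

lemma gluing_covering_Comp:
  assumes cov: "gluing_covering (U, I, \<iota>)"
    and loc: "\<And>i. i \<in> I \<Longrightarrow> gluing_covering (map_dom (\<iota> i), J i, l i)"
    and e: "bij_betw e K (SIGMA i:I. J i)"
  shows "gluing_covering (U, K, \<lambda>k\<in>K. case e k of (i, j) \<Rightarrow> Comp Top (\<iota> i) (l i j))"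
proof -
  define F where "F = (\<lambda>(i, j). Comp Top (\<iota> i) (l i j))"
  have F: "F (i, j) \<in> Arr Top \<and> map_cod (F (i, j)) = U \<and>
      inj_on (map_fun (F (i, j))) (topspace (map_dom (F (i, j)))) \<and>
      map_fun (F (i, j)) ` topspace (map_dom (F (i, j))) =
        map_fun (\<iota> i) ` map_fun (l i j) ` topspace (map_dom (l i j))"
    if i: "i \<in> I" and j: "j \<in> J i" for i j
  proof -
    have \<iota>: "\<iota> i \<in> Arr Top" "map_cod (\<iota> i) = U"
      "inj_on (map_fun (\<iota> i)) (topspace (map_dom (\<iota> i)))"
      using cov i by (auto simp: gluing_covering_iff)
    have l: "l i j \<in> Arr Top" "map_cod (l i j) = map_dom (\<iota> i)"
      "inj_on (map_fun (l i j)) (topspace (map_dom (l i j)))"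
      using loc[OF i] j by (auto simp: gluing_covering_iff)
    have "map_fun (l i j) ` topspace (map_dom (l i j)) \<subseteq> topspace (map_dom (\<iota> i))"
      using Arr_Top_funcset[OF l(1)] l(2) by auto
    then have "inj_on (map_fun (\<iota> i) \<circ> map_fun (l i j)) (topspace (map_dom (l i j)))"
      by (rule comp_inj_on[OF l(3) inj_on_subset[OF \<iota>(3)]])
    then have "inj_on (map_fun (F (i, j))) (topspace (map_dom (F (i, j))))"
      by (simp add: F_def inj_on_def compose_def)
    moreover have "F (i, j) \<in> Arr Top"
      using Comp_Arr_Top[OF l(1) \<iota>(1) l(2)] by (simp add: F_def)
    ultimately show ?thesis
      using \<iota>(2) by (auto simp: F_def compose_def)
  qed
  have eK: "e ` K = Sigma I J"
    using e by (simp add: bij_betw_def)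
  have "(\<Union>k\<in>K. map_fun (F (e k)) ` topspace (map_dom (F (e k)))) =
      (\<Union>s\<in>e ` K. map_fun (F s) ` topspace (map_dom (F s)))" by simp
  also have "\<dots> = (\<Union>i\<in>I. \<Union>j\<in>J i. map_fun (F (i, j)) ` topspace (map_dom (F (i, j))))"
    unfolding eK by auto
  also have "\<dots> = (\<Union>i\<in>I. \<Union>j\<in>J i. map_fun (\<iota> i) ` map_fun (l i j) ` topspace (map_dom (l i j)))"
    by (rule SUP_cong[OF refl], rule SUP_cong[OF refl]) (use F in blast)
  also have "\<dots> = (\<Union>i\<in>I. map_fun (\<iota> i) ` (\<Union>j\<in>J i. map_fun (l i j) ` topspace (map_dom (l i j))))"
    by (simp add: image_UN)
  also have "\<dots> = (\<Union>i\<in>I. map_fun (\<iota> i) ` topspace (map_dom (\<iota> i)))"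
    by (rule SUP_cong[OF refl]) (use loc in \<open>simp add: gluing_covering_iff\<close>)
  also have "\<dots> = topspace U"
    using cov by (simp add: gluing_covering_iff)
  finally have union: "(\<Union>k\<in>K. map_fun (F (e k)) ` topspace (map_dom (F (e k)))) = topspace U" .
  have "F (e k) \<in> Arr Top \<and> map_cod (F (e k)) = U \<and>
      inj_on (map_fun (F (e k))) (topspace (map_dom (F (e k))))" if "k \<in> K" for k
  proof -
    obtain i j where "e k = (i, j)" "i \<in> I" "j \<in> J i"
      using eK \<open>k \<in> K\<close> by blast
    then show ?thesis
      using F[of i j] by simp
  qed
  then have "gluing_covering (U, K, \<lambda>k\<in>K. F (e k))"
    using union by (simp add: gluing_covering_iff)
  then show ?thesis
    by (simp add: F_def)
qed

section \<open>Pullbacks of injective maps\<close>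

lemma is_pullback_mediating:
  assumes "is_pullback C f g p q" "is_cone C f g p' q'"
  obtains h where "h \<in> Arr C" "Dom C h = Dom C p'" "Cod C h = Dom C p"
    "Comp C p h = p'" "Comp C q h = q'"
proof -
  have "\<exists>h. h \<in> Arr C \<and> Dom C h = Dom C p' \<and> Cod C h = Dom C p \<and>
      Comp C p h = p' \<and> Comp C q h = q'"
    using assms unfolding is_pullback_def by (meson ex1_implies_ex)
  then show thesis using that by (elim exE conjE)
qed

text \<open>Both arrows mediate the cone of their common composites, so the uniqueness half of the
  universal property identifies them.\<close>

lemma is_pullback_jointly_monic:
  assumes "category C" and pb: "is_pullback C f g p q"
    and h: "h \<in> Arr C" "Cod C h = Dom C p"
    and h': "h' \<in> Arr C" "Cod C h' = Dom C p"
    and dom: "Dom C h = Dom C h'"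
    and eq: "Comp C p h = Comp C p h'" "Comp C q h = Comp C q h'"
  shows "h = h'"
proof -
  interpret category C by fact
  have f: "f \<in> Arr C" and g: "g \<in> Arr C" and cone: "is_cone C f g p q"
    and univ: "\<And>p' q'. is_cone C f g p' q' \<Longrightarrow>
      \<exists>!h. h \<in> Arr C \<and> Dom C h = Dom C p' \<and> Cod C h = Dom C p \<and>
        Comp C p h = p' \<and> Comp C q h = q'"
    using pb by (simp_all add: is_pullback_def)
  have pq: "p \<in> Arr C" "q \<in> Arr C" "Dom C p = Dom C q" "Cod C p = Dom C f" "Cod C q = Dom C g"
    "Comp C f p = Comp C g q"
    using cone by (simp_all add: is_cone_def)
  have "is_cone C f g (Comp C p h) (Comp C q h)"
    using f g h pq by (simp add: is_cone_def comp_arr comp_dom comp_cod comp_assoc)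
  from univ[OF this] show ?thesis
    by (rule ex1E) (use h h' dom eq pq in \<open>simp add: comp_dom, metis\<close>)
qed

lemma is_cone_Top_iff:
  "is_cone Top f g p q \<longleftrightarrow> p \<in> Arr Top \<and> q \<in> Arr Top \<and> map_dom p = map_dom q \<and>
     map_cod p = map_dom f \<and> map_cod q = map_dom g \<and> map_cod f = map_cod g \<and>
     (\<forall>x\<in>topspace (map_dom p). map_fun f (map_fun p x) = map_fun g (map_fun q x))"
  by (auto simp: is_cone_def compose_def fun_eq_iff restrict_def)

lemma is_cone_oTop_iff:
  "is_cone oTop f g p q \<longleftrightarrow> is_cone Top f g p q \<and> p \<in> Arr oTop \<and> q \<in> Arr oTop"
  by (auto simp: is_cone_def Arr_oTop_iff)

lemma is_cone_Top_image_subset: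
  assumes "is_cone Top f g p q"
  shows "map_fun q ` topspace (map_dom q) \<subseteq>
    {y \<in> topspace (map_dom g). map_fun g y \<in> map_fun f ` topspace (map_dom f)}"
proof clarify
  fix x assume x: "x \<in> topspace (map_dom q)"
  have "map_fun p x \<in> topspace (map_dom f)" "map_fun q x \<in> topspace (map_dom g)"
    using assms x Arr_Top_funcset[of p x] Arr_Top_funcset[of q x] by (auto simp: is_cone_Top_iff)
  moreover have "map_fun g (map_fun q x) = map_fun f (map_fun p x)"
    using assms x by (simp add: is_cone_Top_iff)
  ultimately show "map_fun q x \<in> topspace (map_dom g) \<and>
      map_fun g (map_fun q x) \<in> map_fun f ` topspace (map_dom f)"
    by auto
qed

text \<open>The point \<open>x\<close> of \<open>X\<close> as an arrow; the choice of the underlying element is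
  immaterial, but some element exists because types are nonempty.\<close>

definition point_map :: "'a topology \<Rightarrow> 'a \<Rightarrow> 'a top_map" where
  "point_map X x = Top_Map (discrete_topology {undefined}) (\<lambda>_\<in>{undefined}. x) X"

lemma point_map_simps [simp]:
  "map_dom (point_map X x) = discrete_topology {undefined}"
  "map_cod (point_map X x) = X"
  "map_fun (point_map X x) undefined = x"
  by (simp_all add: point_map_def)

lemma point_map_Arr: "x \<in> topspace X \<Longrightarrow> point_map X x \<in> Arr Top"
  by (simp add: point_map_def Arr_Top_iff)

lemma Comp_point_map:
  "map_cod q = Y \<Longrightarrow> Comp Top q (point_map X x) = point_map Y (map_fun q x)"
  by (auto simp: point_map_def compose_def fun_eq_iff)

text \<open>Points of the pullback correspond to cones with a one-point vertex. Two points with the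
  same \<open>q\<close>-value have the same \<open>p\<close>-value, because \<open>f\<close> is injective, so they mediate the same
  cone; and each pair of points with equal images in the base is such a cone.\<close>

lemma pullback_injective_Top:
  assumes pb: "is_pullback Top f g p q"
    and inj: "inj_on (map_fun f) (topspace (map_dom f))"
  shows "inj_on (map_fun q) (topspace (map_dom q))"
    and "map_fun q ` topspace (map_dom q) =
      {y \<in> topspace (map_dom g). map_fun g y \<in> map_fun f ` topspace (map_dom f)}"
proof -
  have cone: "is_cone Top f g p q" and cod: "map_cod f = map_cod g"
    using pb by (simp_all add: is_pullback_def)
  have p: "p \<in> Arr Top" "map_cod p = map_dom f" "map_dom p = map_dom q"
    and q: "q \<in> Arr Top" "map_cod q = map_dom g"
    and comm: "\<And>x. x \<in> topspace (map_dom q) \<Longrightarrow>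
      map_fun f (map_fun p x) = map_fun g (map_fun q x)"
    using cone by (auto simp: is_cone_Top_iff)
  have point_cone: "is_cone Top f g (point_map (map_dom f) x) (point_map (map_dom g) y)"
    if "x \<in> topspace (map_dom f)" "y \<in> topspace (map_dom g)" "map_fun f x = map_fun g y" for x y
    using that cod by (auto simp: is_cone_Top_iff point_map_Arr)
  show "inj_on (map_fun q) (topspace (map_dom q))"
  proof (rule inj_onI)
    fix x y
    assume x: "x \<in> topspace (map_dom q)" and y: "y \<in> topspace (map_dom q)"
      and eq: "map_fun q x = map_fun q y"
    have px: "map_fun p x \<in> topspace (map_dom f)" and py: "map_fun p y \<in> topspace (map_dom f)"
      using Arr_Top_funcset[OF p(1)] p x y by auto
    have "map_fun f (map_fun p x) = map_fun f (map_fun p y)"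
      using comm x y eq by simp
    then have eqp: "map_fun p x = map_fun p y"
      using inj px py by (auto dest: inj_onD)
    have "point_map (map_dom p) x = point_map (map_dom p) y"
      by (rule is_pullback_jointly_monic[OF category_Top pb])
        (use x y p q eq eqp in \<open>simp_all add: point_map_Arr Comp_point_map del: Top_simps(5)\<close>)
    then show "x = y"
      by (metis point_map_simps(3))
  qed
  show "map_fun q ` topspace (map_dom q) =
      {y \<in> topspace (map_dom g). map_fun g y \<in> map_fun f ` topspace (map_dom f)}"
  proof
    show "{y \<in> topspace (map_dom g). map_fun g y \<in> map_fun f ` topspace (map_dom f)} \<subseteq>
        map_fun q ` topspace (map_dom q)"
    proof clarify
      fix y x
      assume y: "y \<in> topspace (map_dom g)" and x: "x \<in> topspace (map_dom f)"
        and eq: "map_fun g y = map_fun f x"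
      obtain h where h: "h \<in> Arr Top" "map_dom h = discrete_topology {undefined}"
          "map_cod h = map_dom p" "Comp Top q h = point_map (map_dom g) y"
        using is_pullback_mediating[OF pb point_cone[OF x y eq[symmetric]]]
        unfolding Top_simps(2,3) point_map_simps by blast
      have "map_fun (Comp Top q h) undefined = y"
        unfolding h(4) by simp
      then have "map_fun q (map_fun h undefined) = y"
        using h(2) by (simp add: compose_def)
      moreover have "map_fun h undefined \<in> topspace (map_dom q)"
        using Arr_Top_funcset[OF h(1)] h p by simp
      ultimately show "y \<in> map_fun q ` topspace (map_dom q)"
        by blast
    qed
  qed (rule is_cone_Top_image_subset[OF cone])
qed

text \<open>An injective open map \<open>f\<close> is a homeomorphism onto an open subspace, so \<open>f\<inverse> \<circ> g\<close> is again
  open and continuous where it is defined.\<close>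

lemma lift_through_injective_open_map:
  assumes f: "continuous_map X Z f" "open_map X Z f" "inj_on f (topspace X)"
    and g: "continuous_map Y Z g" "open_map Y Z g"
    and S_def: "S = {y \<in> topspace Y. g y \<in> f ` topspace X}"
  obtains k where "continuous_map (subtopology Y S) X k" "open_map (subtopology Y S) X k"
    "\<And>y. y \<in> S \<Longrightarrow> f (k y) = g y"
proof -
  define Z' where "Z' = subtopology Z (f ` topspace X)"
  obtain r where r: "homeomorphic_maps X Z' f r"
    using injective_open_imp_embedding_map[OF f] homeomorphic_map_maps
    unfolding embedding_map_def Z'_def by blast
  then have r': "homeomorphic_map Z' X r"
    using homeomorphic_maps_map by blast
  have g': "continuous_map (subtopology Y S) Z' g" "open_map (subtopology Y S) Z' g"
    unfolding Z'_def
    by (rule continuous_map_into_subtopology[OF continuous_map_from_subtopology[OF g(1)]])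
      (auto simp: S_def intro: open_map_restriction[OF g(2)])
  have "f ` topspace X \<subseteq> topspace Z"
    using f(1) by (auto simp: continuous_map_def)
  then have "f (r z) = z" if "z \<in> f ` topspace X" for z
    using r that by (auto simp: homeomorphic_maps_def Z'_def)
  then have "f ((r \<circ> g) y) = g y" if "y \<in> S" for y
    using that by (simp add: S_def)
  moreover have "continuous_map (subtopology Y S) X (r \<circ> g)"
    using g'(1) homeomorphic_imp_continuous_map[OF r'] continuous_map_compose by blast
  moreover have "open_map (subtopology Y S) X (r \<circ> g)"
    using g'(2) homeomorphic_imp_open_map[OF r'] open_map_compose by blast
  ultimately show thesis
    using that by blast
qed

text \<open>The cone with vertex the open subspace \<open>W\<close> of \<open>V\<close> carried by \<open>S\<close>, the expected image of
  \<open>q\<close>, replaces the one-point cones. Its mediating arrow \<open>h\<close> is a right inverse of \<open>q\<close> over \<open>W\<close>,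
  so \<open>q\<close> maps onto \<open>S\<close>. The composite \<open>e\<close> of \<open>h\<close> with the corestriction of \<open>q\<close> to \<open>W\<close> leaves both
  projections unchanged, hence is the identity, so \<open>h\<close> is also a left inverse.\<close>

lemma pullback_injective_oTop:
  assumes pb: "is_pullback oTop f g p q"
    and inj: "inj_on (map_fun f) (topspace (map_dom f))"
  shows "inj_on (map_fun q) (topspace (map_dom q))"
    and "map_fun q ` topspace (map_dom q) =
      {y \<in> topspace (map_dom g). map_fun g y \<in> map_fun f ` topspace (map_dom f)}"
proof -
  define S where
    "S = {y \<in> topspace (map_dom g). map_fun g y \<in> map_fun f ` topspace (map_dom f)}"
  define W where "W = subtopology (map_dom g) S"
  have W: "topspace W = S"
    by (auto simp: W_def S_def)
  have f: "f \<in> Arr oTop" and g: "g \<in> Arr oTop" and cone: "is_cone oTop f g p q"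
    and cod: "map_cod f = map_cod g"
    using pb by (simp_all add: is_pullback_def)
  have p: "p \<in> Arr oTop" "map_cod p = map_dom f" "map_dom p = map_dom q"
    and q: "q \<in> Arr oTop" "map_cod q = map_dom g"
    and cone': "is_cone Top f g p q"
    and comm: "\<And>x. x \<in> topspace (map_dom q) \<Longrightarrow>
      map_fun f (map_fun p x) = map_fun g (map_fun q x)"
    using cone by (auto simp: is_cone_oTop_iff is_cone_Top_iff)
  have qS: "map_fun q ` topspace (map_dom q) \<subseteq> S"
    using is_cone_Top_image_subset[OF cone'] by (simp add: S_def)
  obtain k where k: "continuous_map W (map_dom f) k" "open_map W (map_dom f) k"
    and fk: "\<And>y. y \<in> S \<Longrightarrow> map_fun f (k y) = map_fun g y"
    unfolding W_def
  proof (rule lift_through_injective_open_map)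
    show "continuous_map (map_dom f) (map_cod g) (map_fun f)"
      "open_map (map_dom f) (map_cod g) (map_fun f)"
      "continuous_map (map_dom g) (map_cod g) (map_fun g)"
      "open_map (map_dom g) (map_cod g) (map_fun g)"
      using f g cod by (simp_all add: Arr_oTop_iff Arr_Top_iff)
  qed (rule inj, rule S_def, blast)
  have "openin (map_cod g) (map_fun f ` topspace (map_dom f))"
    using f cod by (simp add: Arr_oTop_iff open_map_def)
  then have S: "openin (map_dom g) S"
    using g unfolding S_def Arr_oTop_iff Arr_Top_iff by (blast intro: openin_continuous_map_preimage)
  define u where "u = Top_Map W (\<lambda>y\<in>S. k y) (map_dom f)"
  define v where "v = Top_Map W (\<lambda>y\<in>S. y) (map_dom g)"
  have u: "u \<in> Arr oTop"
    using continuous_map_eq[OF k(1)] open_map_eq[OF k(2)]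
    by (simp add: u_def Arr_oTop_iff Arr_Top_iff W)
  have "continuous_map W (map_dom g) id"
    unfolding W_def by (simp add: continuous_map_from_subtopology)
  moreover have "open_map W (map_dom g) id"
    unfolding W_def using S by (rule open_map_inclusion)
  ultimately have v: "v \<in> Arr oTop"
    using continuous_map_eq[of W "map_dom g" id] open_map_eq[of W "map_dom g" id]
    by (simp add: v_def Arr_oTop_iff Arr_Top_iff W)
  have "is_cone oTop f g u v"
    using u v fk cod
    by (auto simp: is_cone_oTop_iff is_cone_Top_iff Arr_oTop_iff u_def v_def W)
  then obtain h where h: "h \<in> Arr oTop" "map_dom h = W" "map_cod h = map_dom p"
      and ph: "Comp Top p h = u" and qh: "Comp Top q h = v"
    using is_pullback_mediating[OF pb, of u v] unfolding oTop_simps u_def top_map.sel by blast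
  have qh': "map_fun q (map_fun h y) = y" if "y \<in> S" for y
    using fun_cong[OF arg_cong[OF qh, of map_fun], of y] that h W by (simp add: compose_def v_def)
  have hS: "map_fun h y \<in> topspace (map_dom q)" if "y \<in> S" for y
    using Arr_Top_funcset[of h y] h p W that by (simp add: Arr_oTop_iff)
  show "map_fun q ` topspace (map_dom q) =
      {y \<in> topspace (map_dom g). map_fun g y \<in> map_fun f ` topspace (map_dom f)}"
    using qS qh' hS unfolding S_def[symmetric] by (force simp: image_iff)
  \<comment> \<open>The corestriction of \<open>q\<close> to \<open>W\<close> is open because \<open>q\<close> is.\<close>
  define c where "c = Top_Map (map_dom q) (map_fun q) W"
  have c: "c \<in> Arr oTop"
    using q qS
    by (auto simp: c_def Arr_oTop_iff Arr_Top_iff W_def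
        intro!: continuous_map_into_subtopology open_map_into_subtopology)
  define e where "e = Comp Top h c"
  have e: "e \<in> Arr oTop" "map_dom e = map_dom p" "map_cod e = map_dom p"
    using Comp_Arr_oTop[OF c h(1)] h p by (auto simp: e_def c_def)
  have e_apply: "map_fun e x = map_fun h (map_fun q x)" if "x \<in> topspace (map_dom q)" for x
    using that by (simp add: e_def c_def compose_def)
  have e_in: "map_fun e x \<in> topspace (map_dom q)" if "x \<in> topspace (map_dom q)" for x
    using that e_apply hS qS by auto
  have q_e: "map_fun q (map_fun e x) = map_fun q x" if "x \<in> topspace (map_dom q)" for x
    using that e_apply qh' qS by auto
  \<comment> \<open>Compatibility with \<open>p\<close> follows from that with \<open>q\<close> after applying the injective map \<open>f\<close>.\<close>
  have p_e: "map_fun p (map_fun e x) = map_fun p x" if x: "x \<in> topspace (map_dom q)" for x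
  proof (rule inj_onD[OF inj])
    show "map_fun f (map_fun p (map_fun e x)) = map_fun f (map_fun p x)"
      using comm x e_in q_e by simp
    show "map_fun p (map_fun e x) \<in> topspace (map_dom f)" "map_fun p x \<in> topspace (map_dom f)"
      using Arr_Top_funcset[of p] p x e_in by (auto simp: Arr_oTop_iff)
  qed
  have pe: "Comp Top p e = p"
    by (rule Arr_Top_eqI)
      (use Comp_Arr_oTop[OF e(1) p(1) e(3)] e p p_e in \<open>auto simp: Arr_oTop_iff compose_def\<close>)
  have qe: "Comp Top q e = q"
    by (rule Arr_Top_eqI)
      (use Comp_Arr_oTop[OF e(1) q(1)] e p q q_e in \<open>auto simp: Arr_oTop_iff compose_def\<close>)
  have pi: "Comp Top p (Ident Top (map_dom p)) = p"
    using category.comp_ident_right[OF category_Top, of p] p by (simp add: Arr_oTop_iff)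
  have qi: "Comp Top q (Ident Top (map_dom p)) = q"
    using category.comp_ident_right[OF category_Top, of q] p q by (simp add: Arr_oTop_iff)
  have e_id: "e = Ident Top (map_dom p)"
    by (rule is_pullback_jointly_monic[OF category_oTop pb])
      (use e pe qe pi qi Ident_Arr_oTop[of "map_dom p"] in \<open>simp_all del: Top_simps(5)\<close>)
  show "inj_on (map_fun q) (topspace (map_dom q))"
  proof (rule inj_on_inverseI)
    fix x assume "x \<in> topspace (map_dom q)"
    then show "map_fun h (map_fun q x) = x"
      using e_apply[of x] p by (simp add: e_id)
  qed
qed

lemma gluing_covering_pullback:
  assumes cov: "gluing_covering (map_cod \<phi>, I, \<iota>)" and \<phi>: "\<phi> \<in> Arr Top"
    and q: "\<And>i. i \<in> I \<Longrightarrow> q i \<in> Arr Top \<and> map_cod (q i) = map_dom \<phi>"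
    and inj: "\<And>i. i \<in> I \<Longrightarrow> inj_on (map_fun (q i)) (topspace (map_dom (q i)))"
    and img: "\<And>i. i \<in> I \<Longrightarrow> map_fun (q i) ` topspace (map_dom (q i)) =
      {y \<in> topspace (map_dom \<phi>). map_fun \<phi> y \<in> map_fun (\<iota> i) ` topspace (map_dom (\<iota> i))}"
  shows "gluing_covering (map_dom \<phi>, I, \<lambda>i\<in>I. q i)"
proof -
  have "(\<Union>i\<in>I. map_fun (q i) ` topspace (map_dom (q i))) =
      {y \<in> topspace (map_dom \<phi>).
        map_fun \<phi> y \<in> (\<Union>i\<in>I. map_fun (\<iota> i) ` topspace (map_dom (\<iota> i)))}"
    using img by auto
  also have "\<dots> = topspace (map_dom \<phi>)"
    using cov Arr_Top_funcset[OF \<phi>] by (auto simp: gluing_covering_iff)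
  finally show ?thesis
    using q inj by (simp add: gluing_covering_iff)
qed

section \<open>The two sites\<close>

lemma grothendieck_site_Top:
  "grothendieck_site (Top :: ('a topology, 'a top_map) cat_data)
     (Cov_Gl_Top :: ('a topology, 'i, 'a top_map) family set)"
proof (intro grothendieck_site.intro category_Top grothendieck_site_axioms.intro)
  show "(Cov_Gl_Top :: ('a topology, 'i, 'a top_map) family set) \<subseteq> families Top"
    by (auto simp: Cov_Gl_Top_def gluing_covering_def)
next
  fix \<phi> :: "'a top_map" and i :: 'i
  assume "is_iso Top \<phi>"
  then show "(Cod Top \<phi>, {i}, \<lambda>_\<in>{i}. \<phi>) \<in> Cov_Gl_Top"
    using gluing_covering_iso by (simp add: Cov_Gl_Top_def)
next
  fix U :: "'a topology" and I K :: "'i set" and \<iota> J l and e :: "'i \<Rightarrow> 'i \<times> 'i"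
  assume "(U, I, \<iota>) \<in> Cov_Gl_Top"
    and "\<And>i. i \<in> I \<Longrightarrow> (Dom Top (\<iota> i), J i, l i) \<in> Cov_Gl_Top"
    and "bij_betw e K (Sigma I J)"
  then show "(U, K, \<lambda>k\<in>K. case e k of (i, j) \<Rightarrow> Comp Top (\<iota> i) (l i j)) \<in> Cov_Gl_Top"
    using gluing_covering_Comp[of U I \<iota> J l e K]
    by (simp add: Cov_Gl_Top_def del: Top_simps(5))
next
  fix U :: "'a topology" and I :: "'i set" and \<iota> \<phi> p q
  assume cov: "(U, I, \<iota>) \<in> Cov_Gl_Top" and \<phi>: "\<phi> \<in> Arr Top" "Cod Top \<phi> = U"
    and pb: "\<And>i. i \<in> I \<Longrightarrow> is_pullback Top (\<iota> i) \<phi> (p i) (q i)"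
  have "gluing_covering (map_dom \<phi>, I, \<lambda>i\<in>I. q i)"
  proof (rule gluing_covering_pullback)
    show "gluing_covering (map_cod \<phi>, I, \<iota>)"
      using cov \<phi> by (simp add: Cov_Gl_Top_def)
    fix i assume i: "i \<in> I"
    have "inj_on (map_fun (\<iota> i)) (topspace (map_dom (\<iota> i)))"
      using cov i by (simp add: Cov_Gl_Top_def gluing_covering_iff)
    note * = pullback_injective_Top[OF pb[OF i] this]
    show "inj_on (map_fun (q i)) (topspace (map_dom (q i)))" by (rule *)
    show "map_fun (q i) ` topspace (map_dom (q i)) =
        {y \<in> topspace (map_dom \<phi>). map_fun \<phi> y \<in> map_fun (\<iota> i) ` topspace (map_dom (\<iota> i))}"
      by (rule *)
    show "q i \<in> Arr Top \<and> map_cod (q i) = map_dom \<phi>"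
      using pb[OF i] by (simp add: is_pullback_def is_cone_Top_iff)
  qed (rule \<phi>)
  then show "(Dom Top \<phi>, I, \<lambda>i\<in>I. q i) \<in> Cov_Gl_Top"
    by (simp add: Cov_Gl_Top_def)
qed

lemma grothendieck_site_oTop:
  "grothendieck_site (oTop :: ('a topology, 'a top_map) cat_data)
     (Cov_Gl_oTop :: ('a topology, 'i, 'a top_map) family set)"
proof (intro grothendieck_site.intro category_oTop grothendieck_site_axioms.intro)
  show "(Cov_Gl_oTop :: ('a topology, 'i, 'a top_map) family set) \<subseteq> families oTop"
    by (auto simp: Cov_Gl_oTop_def gluing_open_covering_def)
next
  fix \<phi> :: "'a top_map" and i :: 'i
  assume iso: "is_iso oTop \<phi>"
  then have "\<phi> \<in> Arr oTop" by (simp add: is_iso_def)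
  then show "(Cod oTop \<phi>, {i}, \<lambda>_\<in>{i}. \<phi>) \<in> Cov_Gl_oTop"
    using gluing_covering_iso[OF is_iso_oTop_imp_Top[OF iso]]
    by (simp add: Cov_Gl_oTop_def gluing_open_covering_iff)
next
  fix U :: "'a topology" and I K :: "'i set" and \<iota> J l and e :: "'i \<Rightarrow> 'i \<times> 'i"
  assume cov: "(U, I, \<iota>) \<in> Cov_Gl_oTop"
    and loc: "\<And>i. i \<in> I \<Longrightarrow> (Dom oTop (\<iota> i), J i, l i) \<in> Cov_Gl_oTop"
    and e: "bij_betw e K (Sigma I J)"
  have "gluing_covering (U, K, \<lambda>k\<in>K. case e k of (i, j) \<Rightarrow> Comp Top (\<iota> i) (l i j))"
    using gluing_covering_Comp[of U I \<iota> J l e K] cov loc e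
    by (simp add: Cov_Gl_oTop_def gluing_open_covering_iff del: Top_simps(5))
  moreover have "(case e k of (i, j) \<Rightarrow> Comp Top (\<iota> i) (l i j)) \<in> Arr oTop" if "k \<in> K" for k
  proof -
    obtain i j where ij: "e k = (i, j)" "i \<in> I" "j \<in> J i"
      using bij_betw_imp_surj_on[OF e] \<open>k \<in> K\<close> by blast
    have "\<iota> i \<in> Arr oTop"
      using cov ij by (simp add: Cov_Gl_oTop_def gluing_open_covering_iff)
    moreover have "l i j \<in> Arr oTop" "map_cod (l i j) = map_dom (\<iota> i)"
      using loc[OF ij(2)] ij
      by (simp_all add: Cov_Gl_oTop_def gluing_open_covering_iff gluing_covering_iff)
    ultimately show ?thesis
      using Comp_Arr_oTop ij(1) by (simp del: Top_simps(5))
  qed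
  ultimately show "(U, K, \<lambda>k\<in>K. case e k of (i, j) \<Rightarrow> Comp oTop (\<iota> i) (l i j)) \<in> Cov_Gl_oTop"
    by (simp add: Cov_Gl_oTop_def gluing_open_covering_iff del: Top_simps(5))
next
  fix U :: "'a topology" and I :: "'i set" and \<iota> \<phi> p q
  assume cov: "(U, I, \<iota>) \<in> Cov_Gl_oTop" and \<phi>: "\<phi> \<in> Arr oTop" "Cod oTop \<phi> = U"
    and pb: "\<And>i. i \<in> I \<Longrightarrow> is_pullback oTop (\<iota> i) \<phi> (p i) (q i)"
  have q: "q i \<in> Arr oTop \<and> map_cod (q i) = map_dom \<phi>" if "i \<in> I" for i
    using pb[OF that] by (simp add: is_pullback_def is_cone_def)
  have "gluing_covering (map_dom \<phi>, I, \<lambda>i\<in>I. q i)"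
  proof (rule gluing_covering_pullback)
    show "gluing_covering (map_cod \<phi>, I, \<iota>)"
      using cov \<phi> by (simp add: Cov_Gl_oTop_def gluing_open_covering_iff)
    show "\<phi> \<in> Arr Top"
      using \<phi> by (simp add: Arr_oTop_iff)
    fix i assume i: "i \<in> I"
    have "inj_on (map_fun (\<iota> i)) (topspace (map_dom (\<iota> i)))"
      using cov i by (simp add: Cov_Gl_oTop_def gluing_open_covering_iff gluing_covering_iff)
    note * = pullback_injective_oTop[OF pb[OF i] this]
    show "inj_on (map_fun (q i)) (topspace (map_dom (q i)))" by (rule *)
    show "map_fun (q i) ` topspace (map_dom (q i)) =
        {y \<in> topspace (map_dom \<phi>). map_fun \<phi> y \<in> map_fun (\<iota> i) ` topspace (map_dom (\<iota> i))}"
      by (rule *)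
    show "q i \<in> Arr Top \<and> map_cod (q i) = map_dom \<phi>"
      using q[OF i] by (simp add: Arr_oTop_iff)
  qed
  then show "(Dom oTop \<phi>, I, \<lambda>i\<in>I. q i) \<in> Cov_Gl_oTop"
    using q by (simp add: Cov_Gl_oTop_def gluing_open_covering_iff)
qed

theorem theorem2p15:
  shows "grothendieck_site (Top :: ('a topology, 'a top_map) cat_data)
           (Cov_Gl_Top :: ('a topology, 'i, 'a top_map) family set) \<and>
         grothendieck_site (oTop :: ('a topology, 'a top_map) cat_data)
           (Cov_Gl_oTop :: ('a topology, 'i, 'a top_map) family set)"
  using grothendieck_site_Top grothendieck_site_oTop by blast

end
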